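(* For all integers $a,b$ with $2\le a\le b$, there exists an integer $t_{(a,b)}\ge 0$ such that $$H_i(\Delta(P(a,b));\mathbb{Z})\neq 0 \quad\text{if and only if}\quad 0\le i\le t_{(a,b)},$$ where $H_i$ denotes the $i$-th (non-reduced) simplicial homology group.
   Context: Here $\mathbb{N}=\{0,1,2,\ldots\}$. For $(a_1,a_2),(b_1,b_2)\in\mathbb{N}^2$, say that $(a_1,a_2)$ properly divides $(b_1,b_2)$ if for each $i$ either $a_i=b_i=0$ or $a_i<b_i$. Write $(a_1,a_2)\le(b_1,b_2)$ if the two are equal or the first properly divides the second; this is a partial order. $P(a,b)$ is the set of all $(c,d)\in\mathbb{N}^2$ with $(c,d)\le(a,b)$, ordered by $\le$; it has unique minimal element $\widehat 0=(0,0)$ and unique maximal element $\widehat 1=(a,b)$. The order complex $\Delta(P(a,b))$ is the simplicial complex of all chains in $P(a,b)\setminus\{\widehat 0,\widehat 1\}$. *)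

theory Defs
  imports Main "HOL-Algebra.Free_Abelian_Groups"
begin

section \<open>The posets \<open>P(a,b)\<close>\<close>

definition properly_divides :: "nat \<times> nat \<Rightarrow> nat \<times> nat \<Rightarrow> bool" where
  "properly_divides x y \<longleftrightarrow>
     (fst x = 0 \<and> fst y = 0 \<or> fst x < fst y) \<and>
     (snd x = 0 \<and> snd y = 0 \<or> snd x < snd y)"

definition pd_le :: "nat \<times> nat \<Rightarrow> nat \<times> nat \<Rightarrow> bool" where
  "pd_le x y \<longleftrightarrow> x = y \<or> properly_divides x y"

lemma pd_le_refl: "pd_le x x"
  by (simp add: pd_le_def)

lemma pd_le_trans: "pd_le x y \<Longrightarrow> pd_le y z \<Longrightarrow> pd_le x z"
  by (auto simp: pd_le_def properly_divides_def)

lemma pd_le_antisym: "pd_le x y \<Longrightarrow> pd_le y x \<Longrightarrow> x = y"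
  by (auto simp: pd_le_def properly_divides_def prod_eq_iff)

definition P_set :: "nat \<Rightarrow> nat \<Rightarrow> (nat \<times> nat) set" where
  "P_set a b = {x. pd_le x (a, b)}"

lemma P_set_least: "(0, 0) \<in> P_set a b" "x \<in> P_set a b \<Longrightarrow> pd_le (0, 0) x"
  by (cases x; auto simp: P_set_def pd_le_def properly_divides_def)+

lemma P_set_greatest: "(a, b) \<in> P_set a b" "x \<in> P_set a b \<Longrightarrow> pd_le x (a, b)"
  by (auto simp: P_set_def pd_le_def)


section \<open>Order complexes\<close>

text \<open>The empty chain is included as a face; it plays no role in the (non-reduced) simplicial
  chain complex below.\<close>

definition order_complex :: "('a \<Rightarrow> 'a \<Rightarrow> bool) \<Rightarrow> 'a set \<Rightarrow> 'a set set" where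
  "order_complex r A = {C. C \<subseteq> A \<and> finite C \<and> Complete_Partial_Order.chain r C}"

definition Delta_P :: "nat \<Rightarrow> nat \<Rightarrow> (nat \<times> nat) set set" where
  "Delta_P a b = order_complex pd_le (P_set a b - {(0, 0), (a, b)})"


section \<open>Simplicial homology with integer coefficients\<close>

text \<open>
  Here a simplicial complex is a set \<open>K\<close> of finite sets, closed under subsets.  As usual, simplices are
  oriented by means of a (reflexive) relation \<open>r\<close> on the vertices which restricts to a linear order
  on every simplex.  For an order complex one takes the order of the poset itself.
\<close>

definition simplices :: "int \<Rightarrow> 'a set set \<Rightarrow> 'a set set" where
  "simplices p K = {s \<in> K. finite s \<and> s \<noteq> {} \<and> int (card s) = p + 1}"

definition simplicial_chain_group :: "int \<Rightarrow> 'a set set \<Rightarrow> ('a set \<Rightarrow>\<^sub>0 int) monoid" where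
  "simplicial_chain_group p K = free_Abelian_group (simplices p K)"

text \<open>
  If \<open>s\<close> has vertices \<open>v\<^sub>0 < \<dots> < v\<^sub>p\<close>, then the exponent belonging to \<open>v\<^sub>i\<close> below is \<open>i\<close>, so that the
  boundary of \<open>s\<close> is the alternating sum of the faces omitting \<open>v\<^sub>i\<close>.  The boundary of a vertex is
  \<open>0\<close>, which makes the homology non-reduced.
\<close>

definition simplex_boundary :: "('a \<Rightarrow> 'a \<Rightarrow> bool) \<Rightarrow> 'a set \<Rightarrow> ('a set \<Rightarrow>\<^sub>0 int)" where
  "simplex_boundary r s =
     (if card s \<le> 1 then 0
      else \<Sum>v\<in>s. frag_cmul ((-1) ^ card {u \<in> s. r u v \<and> u \<noteq> v}) (frag_of (s - {v})))"

definition chain_bd :: "('a \<Rightarrow> 'a \<Rightarrow> bool) \<Rightarrow> ('a set \<Rightarrow>\<^sub>0 int) \<Rightarrow> ('a set \<Rightarrow>\<^sub>0 int)" where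
  "chain_bd r = frag_extend (simplex_boundary r)"

definition simplicial_cycles ::
    "('a \<Rightarrow> 'a \<Rightarrow> bool) \<Rightarrow> int \<Rightarrow> 'a set set \<Rightarrow> ('a set \<Rightarrow>\<^sub>0 int) set" where
  "simplicial_cycles r p K = {c \<in> carrier (simplicial_chain_group p K). chain_bd r c = 0}"

definition simplicial_boundaries ::
    "('a \<Rightarrow> 'a \<Rightarrow> bool) \<Rightarrow> int \<Rightarrow> 'a set set \<Rightarrow> ('a set \<Rightarrow>\<^sub>0 int) set" where
  "simplicial_boundaries r p K = chain_bd r ` carrier (simplicial_chain_group (p + 1) K)"

definition simplicial_homology_group ::
    "('a \<Rightarrow> 'a \<Rightarrow> bool) \<Rightarrow> int \<Rightarrow> 'a set set \<Rightarrow> ('a set \<Rightarrow>\<^sub>0 int) set monoid" where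
  "simplicial_homology_group r p K =
     subgroup_generated (simplicial_chain_group p K) (simplicial_cycles r p K)
       Mod simplicial_boundaries r p K"

end

theory Submission
  imports Defs
begin

text \<open>
  The proof works with the augmented (reduced) chain complex, in which the empty chain is a face and
  faces are graded by their cardinality: a complex is \<open>exact\<close> at \<open>k\<close> if its reduced homology
  vanishes in dimension \<open>k - 1\<close>.  In positive dimensions this is the homology of the statement; in
  dimension \<open>0\<close> the non-reduced homology is nonzero because \<open>\<Delta>(P(a,b))\<close> is nonempty.

  Everything rests on one gluing principle (\<open>exact_insert\<close>).  Suppose that a vertex \<open>x\<close> is added to
  a poset \<open>B\<close>, so that a cone over the link \<open>L\<close> of \<open>x\<close> is glued to the order complex of \<open>B\<close>.
  If some \<open>y \<in> B\<close> is comparable to all of \<open>L\<close>, then \<open>L\<close> is already contracted to \<open>y\<close> inside \<open>B\<close>, and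
  the result looks like the wedge of \<open>B\<close> and the suspension of \<open>L\<close>.  If moreover \<open>y\<close> lies in
  \<open>L\<close>, then \<open>L\<close> itself is a cone and adding \<open>x\<close> changes nothing.

  In the interior of \<open>P(a,b)\<close>, the elements \<open>(0,d)\<close> and \<open>(1,d)\<close> with \<open>d \<ge> 2\<close> are dominated by \<open>(0,1)\<close>,
  and \<open>(c,0)\<close>, \<open>(c,1)\<close> with \<open>c \<ge> 2\<close> by \<open>(1,0)\<close>, so they can be removed.  What remains are the three
  points \<open>(0,1)\<close>, \<open>(1,0)\<close>, \<open>(1,1)\<close> below all of the box \<open>R = [2,a) \<times> [2,b)\<close> with the strict product
  order.  The complex thus behaves like the wedge of two suspensions of \<open>R\<close> (\<open>exact_interior_Suc\<close>).

  The minimal elements of a box \<open>[p,a) \<times> [q,b)\<close> with \<open>p, q \<ge> 1\<close> are those on its lower and left sides.  The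
  corner \<open>(p,q)\<close> lies below \<open>[p+1,a) \<times> [q+1,b)\<close> and makes a cone of it; each other minimal
  element contributes the suspension of a smaller box with the same upper corner
  (\<open>exact_box_Suc\<close>).  By induction on the dimension, the dimensions in which a box has
  nonzero reduced homology, shifted up by one, are closed downwards among the positive integers
  (\<open>exact_box_downward\<close>).  For the first step: if there is a minimal element besides the corner, then
  there is one whose smaller box is empty, and the suspension of the empty complex consists of two points.
\<close>


section \<open>The augmented chain complex of an order complex\<close>

text \<open>
  For two distinct comparable vertices, antisymmetry says that exactly one of them precedes the other.  This
  is what makes the orientation signs below anticommute.
\<close>

locale oriented_vertices =
  fixes r :: "'a \<Rightarrow> 'a \<Rightarrow> bool"
  assumes r_refl: "r x x"
    and r_antisym: "r x y \<Longrightarrow> r y x \<Longrightarrow> x = y"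
begin

abbreviation comparable :: "'a \<Rightarrow> 'a \<Rightarrow> bool" where
  "comparable x y \<equiv> r x y \<or> r y x"

text \<open>
  Graded by cardinality, so that the empty face sits in degree \<open>0\<close> and natural numbers suffice.
\<close>

definition faces :: "'a set \<Rightarrow> nat \<Rightarrow> 'a set set" where
  "faces A k = {s \<in> order_complex r A. card s = k}"

definition face_chains :: "'a set \<Rightarrow> nat \<Rightarrow> ('a set \<Rightarrow>\<^sub>0 int) set" where
  "face_chains A k = {c. Poly_Mapping.keys c \<subseteq> faces A k}"

definition link :: "'a \<Rightarrow> 'a set \<Rightarrow> 'a set" where
  "link x B = {z \<in> B. comparable z x}"

definition sgn_at :: "'a set \<Rightarrow> 'a \<Rightarrow> int" where
  "sgn_at s v = (-1) ^ card {u \<in> s. r u v \<and> u \<noteq> v}"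

text \<open>
  Unlike \<^const>\<open>chain_bd\<close>, this boundary sends a vertex to the empty face.
\<close>

definition boundary :: "('a set \<Rightarrow>\<^sub>0 int) \<Rightarrow> ('a set \<Rightarrow>\<^sub>0 int)" where
  "boundary = frag_extend (\<lambda>s. \<Sum>v\<in>s. frag_cmul (sgn_at s v) (frag_of (s - {v})))"

text \<open>
  Exterior multiplication by \<open>x\<close> from the left.  The sign moves \<open>x\<close> from the first
  position to its place in the order, and a face that contains \<open>x\<close> is sent to \<open>0\<close>.
\<close>

definition cone :: "'a \<Rightarrow> ('a set \<Rightarrow>\<^sub>0 int) \<Rightarrow> ('a set \<Rightarrow>\<^sub>0 int)" where
  "cone x = frag_extend (\<lambda>s. if x \<in> s then 0 else frag_cmul (sgn_at s x) (frag_of (insert x s)))"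

definition exact :: "'a set \<Rightarrow> nat \<Rightarrow> bool" where
  "exact A k \<longleftrightarrow> (\<forall>c \<in> face_chains A k. boundary c = 0 \<longrightarrow> c \<in> boundary ` face_chains A (Suc k))"

lemma boundary_linear [simp]:
  "boundary 0 = 0" "boundary (c + d) = boundary c + boundary d"
  "boundary (c - d) = boundary c - boundary d" "boundary (- c) = - boundary c"
  "boundary (frag_cmul m c) = frag_cmul m (boundary c)"
  by (simp_all add: boundary_def frag_extend_add frag_extend_diff frag_extend_minus frag_extend_cmul)

lemma cone_linear [simp]:
  "cone x 0 = 0" "cone x (c + d) = cone x c + cone x d"
  "cone x (c - d) = cone x c - cone x d" "cone x (- c) = - cone x c"
  "cone x (frag_cmul m c) = frag_cmul m (cone x c)"
  by (simp_all add: cone_def frag_extend_add frag_extend_diff frag_extend_minus frag_extend_cmul)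

lemma boundary_of:
  "boundary (frag_of s) = (\<Sum>v\<in>s. frag_cmul (sgn_at s v) (frag_of (s - {v})))"
  by (simp add: boundary_def)

lemma cone_of:
  "cone x (frag_of s) = (if x \<in> s then 0 else frag_cmul (sgn_at s x) (frag_of (insert x s)))"
  by (simp add: cone_def)

lemma cone_sum: "finite I \<Longrightarrow> cone x (sum f I) = (\<Sum>i\<in>I. cone x (f i))"
  by (induction I rule: finite_induct) auto

lemma faces_iff:
  "s \<in> faces A k \<longleftrightarrow> s \<subseteq> A \<and> finite s \<and> (\<forall>u\<in>s. \<forall>v\<in>s. comparable u v) \<and> card s = k"
  by (auto simp: faces_def order_complex_def chain_def)

lemma faces_mono: "A \<subseteq> B \<Longrightarrow> faces A k \<subseteq> faces B k"
  by (simp add: faces_iff subset_iff)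

lemma face_chains_mono: "c \<in> face_chains A k \<Longrightarrow> A \<subseteq> B \<Longrightarrow> c \<in> face_chains B k"
  using faces_mono[of A B k] unfolding face_chains_def by blast

lemma face_chains_closed [simp]:
  "0 \<in> face_chains A k"
  "c \<in> face_chains A k \<Longrightarrow> d \<in> face_chains A k \<Longrightarrow> c + d \<in> face_chains A k"
  "c \<in> face_chains A k \<Longrightarrow> d \<in> face_chains A k \<Longrightarrow> c - d \<in> face_chains A k"
  "c \<in> face_chains A k \<Longrightarrow> - c \<in> face_chains A k"
  "c \<in> face_chains A k \<Longrightarrow> frag_cmul m c \<in> face_chains A k"
  using Poly_Mapping.keys_add[of c d] keys_diff[of c d] keys_cmul[of m c]
  unfolding face_chains_def by (auto simp: keys_minus)

lemma face_chains_sum: "finite I \<Longrightarrow> (\<And>i. i \<in> I \<Longrightarrow> f i \<in> face_chains A k) \<Longrightarrow> sum f I \<in> face_chains A k"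
  by (induction I rule: finite_induct) auto

lemma frag_of_in_chains [simp]: "frag_of s \<in> face_chains A k \<longleftrightarrow> s \<in> faces A k"
  by (simp add: face_chains_def)

lemma face_chains_induct [consumes 1, case_names zero face diff]:
  assumes "c \<in> face_chains A k" "P 0" "\<And>s. s \<in> faces A k \<Longrightarrow> P (frag_of s)"
    "\<And>c d. P c \<Longrightarrow> P d \<Longrightarrow> P (c - d)"
  shows "P c"
  using assms(1) unfolding face_chains_def
  by (auto intro: frag_induction[of c "faces A k" P] assms)

lemma boundary_in_chains:
  assumes "c \<in> face_chains A (Suc k)"
  shows "boundary c \<in> face_chains A k"
  using assms
proof (induction rule: face_chains_induct)
  case (face s)
  then show ?case
    unfolding boundary_of faces_iff
    by (intro face_chains_sum face_chains_closed(5)) (auto simp: faces_iff)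
qed auto

lemma cone_in_chains:
  assumes "c \<in> face_chains B k" "insert x B \<subseteq> A" "\<And>z. z \<in> B \<Longrightarrow> comparable z x"
  shows "cone x c \<in> face_chains A (Suc k)"
  using assms(1)
proof (induction rule: face_chains_induct)
  case (face s)
  then have "insert x s \<in> faces A (Suc k)" if "x \<notin> s"
    using assms(2,3) that r_refl by (auto simp: faces_iff)
  then show ?case
    by (auto simp: cone_of)
qed auto

lemma sgn_at_insert_above:
  assumes "finite s" "x \<notin> s" "r x v" "x \<noteq> v"
  shows "sgn_at (insert x s) v = - sgn_at s v"
proof -
  have "{u \<in> insert x s. r u v \<and> u \<noteq> v} = insert x {u \<in> s. r u v \<and> u \<noteq> v}"
    using assms by auto
  then show ?thesis
    using assms by (simp add: sgn_at_def)
qed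

lemma sgn_at_insert_other:
  assumes "\<not> (r x v \<and> x \<noteq> v)"
  shows "sgn_at (insert x s) v = sgn_at s v"
proof -
  have "{u \<in> insert x s. r u v \<and> u \<noteq> v} = {u \<in> s. r u v \<and> u \<noteq> v}"
    using assms by auto
  then show ?thesis
    by (simp add: sgn_at_def)
qed

text \<open>
  Inserting \<open>x\<close> and deleting \<open>v\<close> anticommute: whichever of the two comes first is counted in the position of
  the other, so performing the operations in the other order changes exactly one of the two exponents by one.
\<close>

lemma sgn_at_swap:
  assumes "finite t" "x \<notin> t" "v \<notin> t" "x \<noteq> v" "comparable v x"
  shows "sgn_at (insert v t) x * sgn_at (insert x (insert v t)) v = - (sgn_at (insert v t) v * sgn_at t x)"
proof (cases "r v x")
  case True
  then have "\<not> r x v"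
    using r_antisym assms by blast
  then show ?thesis
    using True assms sgn_at_insert_above[of t v x] sgn_at_insert_other[of x v]
    by (simp add: sgn_at_insert_other)
next
  case False
  then have "r x v"
    using assms by blast
  moreover have "sgn_at (insert x (insert v t)) v = - sgn_at (insert v t) v"
    using assms \<open>r x v\<close> by (intro sgn_at_insert_above) auto
  ultimately show ?thesis
    using False by (simp add: sgn_at_insert_other)
qed

lemma sgn_at_square: "sgn_at s v * sgn_at s v = 1"
  by (simp add: sgn_at_def flip: power_add)

lemma boundary_cone_of:
  assumes "finite s" "\<And>z. z \<in> s \<Longrightarrow> comparable z x"
  shows "boundary (cone x (frag_of s)) = frag_of s - cone x (boundary (frag_of s))"
proof (cases "x \<in> s")
  case True
  have "cone x (boundary (frag_of s))
      = (\<Sum>v\<in>s. if v = x then frag_of s else 0)"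
    unfolding boundary_of cone_sum[OF assms(1)]
  proof (rule sum.cong)
    fix v assume "v \<in> s"
    have "sgn_at s x * sgn_at (s - {x}) x = 1"
      using sgn_at_insert_other[of x x "s - {x}"] True by (simp add: insert_absorb sgn_at_square)
    then show "cone x (frag_cmul (sgn_at s v) (frag_of (s - {v}))) = (if v = x then frag_of s else 0)"
      using True by (auto simp: cone_of insert_absorb)
  qed simp
  then show ?thesis
    using True assms(1) by (simp add: cone_of)
next
  case False
  have "boundary (cone x (frag_of s))
      = (\<Sum>v\<in>insert x s. frag_cmul (sgn_at s x * sgn_at (insert x s) v) (frag_of (insert x s - {v})))"
    using False by (simp add: cone_of boundary_of frag_cmul_sum)
  also have "\<dots> = frag_of s
      + (\<Sum>v\<in>s. frag_cmul (sgn_at s x * sgn_at (insert x s) v) (frag_of (insert x s - {v})))"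
    using False assms(1) by (simp add: sgn_at_insert_other sgn_at_square)
  also have "(\<Sum>v\<in>s. frag_cmul (sgn_at s x * sgn_at (insert x s) v) (frag_of (insert x s - {v})))
      = (\<Sum>v\<in>s. - cone x (frag_cmul (sgn_at s v) (frag_of (s - {v}))))"
  proof (rule sum.cong)
    fix v assume v: "v \<in> s"
    have "sgn_at s x * sgn_at (insert x s) v = - (sgn_at s v * sgn_at (s - {v}) x)"
      using sgn_at_swap[of "s - {v}" x v] v False assms by (auto simp: insert_absorb)
    moreover have "insert x s - {v} = insert x (s - {v})"
      using v False by auto
    ultimately show "frag_cmul (sgn_at s x * sgn_at (insert x s) v) (frag_of (insert x s - {v}))
        = - cone x (frag_cmul (sgn_at s v) (frag_of (s - {v})))"
      using False by (simp add: cone_of)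
  qed simp
  also have "\<dots> = - cone x (boundary (frag_of s))"
    by (simp add: boundary_of cone_sum[OF assms(1)] flip: sum_negf)
  finally show ?thesis
    by simp
qed

text \<open>
  The contracting homotopy of a cone.  The formula also holds for faces that contain \<open>x\<close>: there the
  left-hand side is \<open>0\<close>, and only the summand of the boundary that omits \<open>x\<close> survives on the right.
  Hence it applies when \<open>x\<close> itself belongs to \<open>B\<close>.
\<close>

lemma boundary_cone:
  assumes "c \<in> face_chains B k" "\<And>z. z \<in> B \<Longrightarrow> comparable z x"
  shows "boundary (cone x c) = c - cone x (boundary c)"
  using assms(1)
proof (induction rule: face_chains_induct)
  case (face s)
  then show ?case
    using assms(2) by (intro boundary_cone_of) (auto simp: faces_iff)
qed auto

text \<open>
  By induction along \<open>boundary (cone x c) = c - cone x (boundary c)\<close>: applying the boundary twice to a cone over \<open>t\<close>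
  gives the cone over the double boundary of \<open>t\<close>.
\<close>

lemma boundary_boundary_of:
  assumes "finite s" "\<forall>u\<in>s. \<forall>v\<in>s. comparable u v"
  shows "boundary (boundary (frag_of s)) = 0"
  using assms
proof (induction s rule: finite_induct)
  case empty
  then show ?case
    by (simp add: boundary_of)
next
  case (insert x t)
  have t: "frag_of t \<in> face_chains t (card t)"
    using insert by (simp add: faces_iff)
  have bt: "boundary (frag_of t) \<in> face_chains t (card t - 1)"
  proof (cases "card t")
    case 0
    then show ?thesis
      using insert by (simp add: boundary_of)
  next
    case (Suc n)
    then show ?thesis
      using t boundary_in_chains by auto
  qed
  have comp: "comparable z x" if "z \<in> t" for z
    using insert.prems that by auto
  have "boundary (boundary (cone x (frag_of t))) = cone x (boundary (boundary (frag_of t)))"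
    by (simp add: boundary_cone[OF t comp] boundary_cone[OF bt comp])
  also have "\<dots> = 0"
    using insert by simp
  finally have "boundary (boundary (frag_cmul (sgn_at t x) (cone x (frag_of t)))) = 0"
    by simp
  moreover have "frag_cmul (sgn_at t x) (cone x (frag_of t)) = frag_of (insert x t)"
    using insert.hyps by (simp add: cone_of sgn_at_square)
  ultimately show ?case
    by simp
qed

lemma boundary_boundary:
  assumes "c \<in> face_chains A k"
  shows "boundary (boundary c) = 0"
  using assms
proof (induction rule: face_chains_induct)
  case (face s)
  then show ?case
    by (intro boundary_boundary_of) (auto simp: faces_iff)
qed auto

text \<open>
  Sorting the faces by whether they contain \<open>x\<close> displays the complex on \<open>insert x B\<close> as \<open>B\<close> with a cone
  over the link glued on.
\<close>

lemma chain_decomp: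
  assumes "c \<in> face_chains (insert x B) (Suc k)" "x \<notin> B"
  obtains c0 d where "c0 \<in> face_chains B (Suc k)" "d \<in> face_chains (link x B) k" "c = c0 + cone x d"
proof -
  have "\<exists>c0 \<in> face_chains B (Suc k). \<exists>d \<in> face_chains (link x B) k. c = c0 + cone x d"
    using assms(1)
  proof (induction rule: face_chains_induct)
    case zero
    show ?case
      by (rule bexI[of _ 0], rule bexI[of _ 0]) auto
  next
    case (face s)
    show ?case
    proof (cases "x \<in> s")
      case True
      then have "s - {x} \<in> faces (link x B) k"
        using face by (auto simp: faces_iff link_def)
      moreover have "cone x (frag_cmul (sgn_at (s - {x}) x) (frag_of (s - {x}))) = frag_of s"
        using True by (simp add: cone_of sgn_at_square insert_absorb)
      ultimately show ?thesis
        by (intro bexI[of _ 0] bexI[of _ "frag_cmul (sgn_at (s - {x}) x) (frag_of (s - {x}))"]) auto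
    next
      case False
      then have "s \<in> faces B (Suc k)"
        using face by (auto simp: faces_iff)
      then show ?thesis
        by (intro bexI[of _ "frag_of s"] bexI[of _ 0]) auto
    qed
  next
    case (diff c d)
    then obtain c0 c1 d0 d1 where "c0 \<in> face_chains B (Suc k)" "c1 \<in> face_chains (link x B) k"
      "c = c0 + cone x c1" "d0 \<in> face_chains B (Suc k)" "d1 \<in> face_chains (link x B) k" "d = d0 + cone x d1"
      by blast
    then show ?case
      by (intro bexI[of _ "c0 - d0"] bexI[of _ "c1 - d1"]) auto
  qed
  then show ?thesis
    using that by blast
qed

text \<open>
  The faces of \<open>c0\<close> avoid \<open>x\<close> and those of \<open>cone x d\<close> contain it, so both chains vanish.  Then the homotopy formula
  writes \<open>d\<close>, whose faces avoid \<open>x\<close>, as a cone with apex \<open>x\<close>.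
\<close>

lemma chain_decomp_unique:
  assumes c0: "c0 \<in> face_chains B j" and d: "d \<in> face_chains (link x B) k" and x: "x \<notin> B"
    and eq: "c0 + cone x d = 0"
  shows "c0 = 0" "d = 0"
proof -
  have cone_keys: "x \<in> s" if "s \<in> Poly_Mapping.keys (cone x e)" for e s
    using keys_frag_extend that unfolding cone_def by (fastforce split: if_splits)
  have no_x: "c = 0" if "c \<in> face_chains B' i" "x \<notin> B'" "c = cone x e" for c e B' i
  proof -
    have "s \<notin> Poly_Mapping.keys c" for s
    proof
      assume s: "s \<in> Poly_Mapping.keys c"
      then have "x \<in> s"
        using cone_keys that(3) by blast
      moreover have "s \<in> faces B' i"
        using s that(1) unfolding face_chains_def by blast
      ultimately show False
        using that(2) by (auto simp: faces_iff)
    qed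
    then show ?thesis
      by (metis ex_in_conv keys_eq_empty)
  qed
  have "c0 = cone x (- d)"
    using eq by (simp add: eq_neg_iff_add_eq_0)
  then show "c0 = 0"
    using no_x c0 x by blast
  then have "d = cone x (boundary d)"
    using eq boundary_cone[OF d, of x] by (simp add: link_def)
  moreover have "x \<notin> link x B"
    using x by (simp add: link_def)
  ultimately show "d = 0"
    using no_x d by blast
qed


section \<open>Adding vertices whose links contract\<close>

lemma exact_cone:
  assumes "y \<in> A" "\<And>z. z \<in> A \<Longrightarrow> comparable z y"
  shows "exact A k"
  unfolding exact_def
proof (intro ballI impI)
  fix c assume "c \<in> face_chains A k" "boundary c = 0"
  then have "c = boundary (cone y c)" "cone y c \<in> face_chains A (Suc k)"
    using assms by (simp_all add: boundary_cone cone_in_chains insert_absorb)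
  then show "c \<in> boundary ` face_chains A (Suc k)"
    by blast
qed

text \<open>
  A segment of the Mayer-Vietoris sequence for gluing the cone over the link of \<open>x\<close> to \<open>B\<close>, when the
  inclusion of the link into \<open>B\<close> is null-homologous: every cycle of the link bounds its cone with apex
  \<open>y\<close>, so the sequence breaks up into short ones.
\<close>

lemma exact_insert:
  assumes x: "x \<notin> B" and y: "y \<in> B" and dom: "\<And>z. z \<in> link x B \<Longrightarrow> comparable z y"
  shows "exact (insert x B) (Suc j) \<longleftrightarrow> exact B (Suc j) \<and> exact (link x B) j"
proof -
  let ?A = "insert x B" and ?L = "link x B"
  have L: "?L \<subseteq> B" and Lx: "\<And>z. z \<in> ?L \<Longrightarrow> comparable z x"
    by (auto simp: link_def)
  have conex: "cone x d \<in> face_chains ?A (Suc k)" "boundary (cone x d) = d - cone x (boundary d)"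
    if "d \<in> face_chains ?L k" for d k
    using that L Lx by (auto intro!: cone_in_chains boundary_cone)
  have coney: "cone y d \<in> face_chains B (Suc k)" "boundary (cone y d) = d - cone y (boundary d)"
    if "d \<in> face_chains ?L k" for d k
    using that L y dom by (auto intro!: cone_in_chains boundary_cone)
  have BA: "c \<in> face_chains ?A k" if "c \<in> face_chains B k" for c k
    using that by (rule face_chains_mono) auto
  have LB: "c \<in> face_chains B k" if "c \<in> face_chains ?L k" for c k
    using that L by (rule face_chains_mono)
  show ?thesis
  proof (intro iffI conjI)
    assume A: "exact ?A (Suc j)"
    show "exact B (Suc j)"
      unfolding exact_def
    proof (intro ballI impI)
      fix c assume c: "c \<in> face_chains B (Suc j)" "boundary c = 0"
      then obtain e where e: "e \<in> face_chains ?A (Suc (Suc j))" "c = boundary e"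
        using A BA unfolding exact_def by blast
      obtain e0 d where ed: "e0 \<in> face_chains B (Suc (Suc j))" "d \<in> face_chains ?L (Suc j)"
        "e = e0 + cone x d"
        using chain_decomp[OF e(1) x] by blast
      have "(c - boundary e0 - d) + cone x (boundary d) = 0"
        using e ed conex(2)[OF ed(2)] by simp
      moreover have "c - boundary e0 - d \<in> face_chains B (Suc j)"
        using c ed LB boundary_in_chains by auto
      ultimately have "c - boundary e0 - d = 0" "boundary d = 0"
        using chain_decomp_unique[OF _ boundary_in_chains[OF ed(2)] x] by blast+
      \<comment> \<open>the link part \<open>d\<close> of the filling is a cycle, so it can be filled from \<open>y\<close> instead of \<open>x\<close>\<close>
      then have "c = boundary (e0 + cone y d)"
        using coney(2)[OF ed(2)] by (simp add: algebra_simps)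
      moreover have "e0 + cone y d \<in> face_chains B (Suc (Suc j))"
        using ed coney(1) by simp
      ultimately show "c \<in> boundary ` face_chains B (Suc (Suc j))"
        by blast
    qed
    show "exact ?L j"
      unfolding exact_def
    proof (intro ballI impI)
      fix z assume z: "z \<in> face_chains ?L j" "boundary z = 0"
      \<comment> \<open>the suspension of \<open>z\<close> with poles \<open>x\<close> and \<open>y\<close>\<close>
      have "cone x z - cone y z \<in> face_chains ?A (Suc j)"
        using z conex coney BA by auto
      moreover have "boundary (cone x z - cone y z) = 0"
        using z conex coney by simp
      ultimately obtain e where e: "e \<in> face_chains ?A (Suc (Suc j))" "cone x z - cone y z = boundary e"
        using A unfolding exact_def by blast
      obtain e0 d where ed: "e0 \<in> face_chains B (Suc (Suc j))" "d \<in> face_chains ?L (Suc j)"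
        "e = e0 + cone x d"
        using chain_decomp[OF e(1) x] by blast
      have "(- cone y z - boundary e0 - d) + cone x (z + boundary d) = 0"
        using e ed conex(2)[OF ed(2)] by (simp add: algebra_simps)
      moreover have "- cone y z - boundary e0 - d \<in> face_chains B (Suc j)"
        using z coney ed LB boundary_in_chains by auto
      moreover have "z + boundary d \<in> face_chains ?L j"
        using z ed boundary_in_chains by auto
      ultimately have "z + boundary d = 0"
        using chain_decomp_unique x by blast
      then have "z = boundary (- d)"
        by (simp add: eq_neg_iff_add_eq_0)
      then show "z \<in> boundary ` face_chains ?L (Suc j)"
        using ed by (intro image_eqI[of _ _ "- d"]) auto
    qed
  next
    assume BL: "exact B (Suc j) \<and> exact ?L j"
    show "exact ?A (Suc j)"
      unfolding exact_def
    proof (intro ballI impI)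
      fix c assume c: "c \<in> face_chains ?A (Suc j)" "boundary c = 0"
      obtain c0 d where cd: "c0 \<in> face_chains B (Suc j)" "d \<in> face_chains ?L j" "c = c0 + cone x d"
        using chain_decomp[OF c(1) x] by blast
      have eq: "(boundary c0 + d) + cone x (- boundary d) = 0"
        using c cd conex(2)[OF cd(2)] by (simp add: algebra_simps)
      have dbd: "boundary d = 0 \<and> boundary c0 + d = 0"
      proof (cases j)
        \<comment> \<open>for \<open>j = 0\<close>, \<open>d\<close> is a multiple of the empty face, whose boundary is an empty sum\<close>
        case 0
        have "boundary d = 0"
          using cd(2) unfolding 0
          by (induction rule: face_chains_induct) (auto simp: faces_iff boundary_of)
        then show ?thesis
          using eq by simp
      next
        case (Suc i)
        have "boundary c0 + d \<in> face_chains B j" "- boundary d \<in> face_chains ?L i"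
          using cd LB boundary_in_chains Suc by auto
        then have "boundary c0 + d = 0 \<and> - boundary d = 0"
          using chain_decomp_unique x eq by blast
        then show ?thesis
          by simp
      qed
      obtain e where e: "e \<in> face_chains ?L (Suc j)" "d = boundary e"
        using BL cd dbd unfolding exact_def by blast
      \<comment> \<open>adding the boundary of \<open>cone x e\<close> pushes \<open>c\<close> off \<open>x\<close>\<close>
      have "c0 + e \<in> face_chains B (Suc j)" "boundary (c0 + e) = 0"
        using cd e LB dbd by auto
      then obtain f where f: "f \<in> face_chains B (Suc (Suc j))" "c0 + e = boundary f"
        using BL unfolding exact_def by blast
      have "boundary (f - cone x e) = c"
        using conex(2)[OF e(1)] f(2) cd(3) e(2) by (simp flip: f(2))
      moreover have "f - cone x e \<in> face_chains ?A (Suc (Suc j))"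
        using f e BA conex by auto
      ultimately show "c \<in> boundary ` face_chains ?A (Suc (Suc j))"
        by blast
    qed
  qed
qed

text \<open>
  Here \<open>y\<close> lies in each link, which is therefore a cone.
\<close>

lemma exact_Un_dominated:
  assumes "finite M" and y: "y \<in> B" and My: "\<And>x. x \<in> M \<Longrightarrow> comparable x y"
    and dom: "\<And>x z. x \<in> M \<Longrightarrow> z \<in> B \<union> M \<Longrightarrow> comparable z x \<Longrightarrow> comparable z y"
  shows "exact (B \<union> M) (Suc j) \<longleftrightarrow> exact B (Suc j)"
  using assms(1) My dom
proof (induction M rule: finite_induct)
  case (insert x M)
  have IH: "exact (B \<union> M) (Suc j) \<longleftrightarrow> exact B (Suc j)"
    using insert.prems by (intro insert.IH) blast+
  show ?case
  proof (cases "x \<in> B")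
    case True
    then show ?thesis
      using IH by (simp add: insert_absorb)
  next
    case False
    have dom': "\<And>z. z \<in> link x (B \<union> M) \<Longrightarrow> comparable z y"
      using insert.prems unfolding link_def by blast
    moreover have "y \<in> link x (B \<union> M)"
      using y insert.prems(1)[of x] by (auto simp: link_def)
    ultimately have "exact (link x (B \<union> M)) j"
      by (intro exact_cone)
    then show ?thesis
      using exact_insert[of x "B \<union> M" y j] dom' False insert.hyps y IH by auto
  qed
qed simp

text \<open>
  As the elements of \<open>M\<close> are pairwise incomparable, their links do not change while the others are added.
\<close>

lemma exact_Un_antichain:
  assumes "finite M" and "M \<inter> B = {}" and y: "y \<in> B"
    and dom: "\<And>x z. x \<in> M \<Longrightarrow> z \<in> B \<Longrightarrow> comparable z x \<Longrightarrow> comparable z y"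
    and anti: "\<And>x x'. x \<in> M \<Longrightarrow> x' \<in> M \<Longrightarrow> comparable x x' \<Longrightarrow> x = x'"
  shows "exact (B \<union> M) (Suc j) \<longleftrightarrow> exact B (Suc j) \<and> (\<forall>x\<in>M. exact (link x B) j)"
  using assms(1,2) dom anti
proof (induction M rule: finite_induct)
  case (insert x M)
  have IH: "exact (B \<union> M) (Suc j) \<longleftrightarrow> exact B (Suc j) \<and> (\<forall>x\<in>M. exact (link x B) j)"
    using insert.prems by (intro insert.IH) blast+
  have link: "link x (B \<union> M) = link x B"
    using insert.prems(3) insert.hyps unfolding link_def by blast
  have "comparable z y" if "z \<in> link x (B \<union> M)" for z
    using that insert.prems(2) unfolding link by (auto simp: link_def)
  then have "exact (insert x (B \<union> M)) (Suc j) \<longleftrightarrow> exact (B \<union> M) (Suc j) \<and> exact (link x B) j"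
    using exact_insert[of x "B \<union> M" y j] link insert.hyps insert.prems y by auto
  then show ?case
    using IH by auto
qed simp

text \<open>
  The reduced homology in dimension \<open>-1\<close> is nonzero only for the empty complex.  The recursions below bottom out here.
\<close>

lemma exact_zero_iff: "exact A 0 \<longleftrightarrow> A \<noteq> {}"
proof
  assume *: "exact A 0"
  show "A \<noteq> {}"
  proof
    assume A: "A = {}"
    have "e = 0" if "e \<in> face_chains {} (Suc 0)" for e
      using that by (induction rule: face_chains_induct) (auto simp: faces_iff)
    moreover have "frag_of {} \<in> face_chains A 0" "boundary (frag_of {}) = 0"
      by (auto simp: faces_iff boundary_of)
    then have "frag_of {} \<in> boundary ` face_chains A (Suc 0)"
      using * unfolding exact_def by blast
    ultimately have "frag_of ({}::'a set) = 0"
      unfolding A by force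
    then show False
      by simp
  qed
next
  assume "A \<noteq> {}"
  then obtain y where y: "y \<in> A"
    by blast
  show "exact A 0"
    unfolding exact_def
  proof (intro ballI impI)
    fix c assume c: "c \<in> face_chains A 0" "boundary c = 0"
    have "faces A 0 \<subseteq> faces {} 0"
      by (auto simp: faces_iff)
    then have "c \<in> face_chains {} 0"
      using c(1) unfolding face_chains_def by blast
    then have "c = boundary (cone y c)" "cone y c \<in> face_chains A (Suc 0)"
      using c(2) y boundary_cone[of c "{}"] cone_in_chains[of c "{}"] by auto
    then show "c \<in> boundary ` face_chains A (Suc 0)"
      by blast
  qed
qed

lemma exact_above_card:
  assumes "finite A" "card A < k"
  shows "exact A k"
proof -
  have "faces A k = {}"
    using assms(2) by (auto simp: faces_iff dest!: card_mono[OF assms(1)])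
  then show ?thesis
    by (auto simp: exact_def face_chains_def intro: image_eqI[of _ _ 0])
qed


end


section \<open>Comparison with simplicial homology groups\<close>

lemma trivial_quotient_iff:
  assumes G: "comm_group G" and Z: "subgroup Z G" and B: "subgroup B G" and "B \<subseteq> Z"
  shows "trivial_group (subgroup_generated G Z Mod B) \<longleftrightarrow> Z \<subseteq> B"
proof -
  interpret G: comm_group G
    by (rule G)
  let ?H = "subgroup_generated G Z"
  interpret H: comm_group ?H
    by (rule G.abelian_subgroup_generated[OF G])
  have carrier: "carrier ?H = Z"
    using Z by (rule subgroup.carrier_subgroup_generated_subgroup)
  have BH: "subgroup B ?H"
    using G.subgroup_subgroup_generated_iff[of B Z] B \<open>B \<subseteq> Z\<close> carrier by simp
  then have normal: "normal B ?H"
    by (rule H.subgroup_imp_normal)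
  have "trivial_group (?H Mod B) \<longleftrightarrow> rcosets\<^bsub>?H\<^esub> B = {B}"
    using normal.factorgroup_is_group[OF normal] by (simp add: trivial_group_def FactGroup_def)
  also have "\<dots> \<longleftrightarrow> Z \<subseteq> B"
  proof
    assume *: "rcosets\<^bsub>?H\<^esub> B = {B}"
    show "Z \<subseteq> B"
    proof
      fix z assume z: "z \<in> Z"
      then have "B #>\<^bsub>?H\<^esub> z = B"
        using * carrier unfolding RCOSETS_def by blast
      then show "z \<in> B"
        using H.rcos_self[OF _ BH, of z] z carrier by simp
    qed
  next
    assume "Z \<subseteq> B"
    then have "B #>\<^bsub>?H\<^esub> z = B" if "z \<in> Z" for z
      using H.coset_join2[OF _ BH, of z] that carrier by blast
    moreover have "Z \<noteq> {}"
      using Z subgroup.one_closed by blast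
    ultimately show "rcosets\<^bsub>?H\<^esub> B = {B}"
      unfolding RCOSETS_def carrier by blast
  qed
  finally show ?thesis .
qed

context oriented_vertices
begin

lemma chain_bd_linear:
  "chain_bd r 0 = 0" "chain_bd r (c + d) = chain_bd r c + chain_bd r d"
  "chain_bd r (c - d) = chain_bd r c - chain_bd r d" "chain_bd r (- c) = - chain_bd r c"
  by (simp_all add: chain_bd_def frag_extend_add frag_extend_diff frag_extend_minus)

lemma chain_bd_eq_boundary:
  assumes "c \<in> face_chains A (Suc (Suc k))"
  shows "chain_bd r c = boundary c"
  unfolding chain_bd_def boundary_def
proof (rule frag_extend_eq)
  fix s assume "s \<in> Poly_Mapping.keys c"
  then have "card s = Suc (Suc k)"
    using assms by (auto simp: face_chains_def faces_iff dest: subsetD)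
  then show "simplex_boundary r s = (\<Sum>v\<in>s. frag_cmul (sgn_at s v) (frag_of (s - {v})))"
    by (simp add: simplex_boundary_def sgn_at_def)
qed

lemma chain_bd_vertices:
  assumes "c \<in> face_chains A (Suc 0)"
  shows "chain_bd r c = 0"
  unfolding chain_bd_def
proof (rule frag_extend_eq_0)
  fix s assume "s \<in> Poly_Mapping.keys c"
  then have "card s = Suc 0"
    using assms by (auto simp: face_chains_def faces_iff dest: subsetD)
  then show "simplex_boundary r s = 0"
    by (simp add: simplex_boundary_def)
qed

lemma carrier_simplicial_chain_group:
  "carrier (simplicial_chain_group (int k) (order_complex r A)) = face_chains A (Suc k)"
proof -
  have simplices: "simplices (int k) (order_complex r A) = faces A (Suc k)"
    by (auto simp: simplices_def faces_def order_complex_def card_eq_0_iff)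
  show ?thesis
    unfolding simplicial_chain_group_def simplices face_chains_def by (rule Set.set_eqI) simp
qed

text \<open>
  Degree \<open>k = 0\<close> is special, since \<^const>\<open>chain_bd\<close> kills vertices by convention.
\<close>

lemma chain_bd_face_chains:
  assumes "c \<in> face_chains A (Suc (Suc k))"
  shows "chain_bd r c \<in> face_chains A (Suc k)" "chain_bd r (chain_bd r c) = 0"
proof -
  have b: "boundary c \<in> face_chains A (Suc k)"
    using assms by (rule boundary_in_chains)
  then show "chain_bd r c \<in> face_chains A (Suc k)"
    using assms by (simp add: chain_bd_eq_boundary)
  show "chain_bd r (chain_bd r c) = 0"
  proof (cases k)
    case 0
    then show ?thesis
      using b assms by (simp add: chain_bd_eq_boundary chain_bd_vertices)
  next
    case (Suc j)
    then show ?thesis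
      using b assms chain_bd_eq_boundary[of "boundary c" A j] boundary_boundary[OF assms]
      by (simp add: chain_bd_eq_boundary)
  qed
qed

text \<open>
  That boundaries are cycles makes them a normal subgroup of the cycles, and the set of cosets a group.
\<close>

lemma trivial_homology_iff:
  "trivial_group (simplicial_homology_group r (int k) (order_complex r A)) \<longleftrightarrow>
    {c \<in> face_chains A (Suc k). chain_bd r c = 0} \<subseteq> chain_bd r ` face_chains A (Suc (Suc k))"
proof -
  let ?G = "simplicial_chain_group (int k) (order_complex r A)"
  have carrier: "carrier ?G = face_chains A (Suc k)"
    by (rule carrier_simplicial_chain_group)
  have ops: "x \<otimes>\<^bsub>?G\<^esub> y = x + y" "\<one>\<^bsub>?G\<^esub> = 0" for x y
    by (simp_all add: simplicial_chain_group_def)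
  have inv: "inv\<^bsub>?G\<^esub> x = - x" if "x \<in> face_chains A (Suc k)" for x
    using that unfolding carrier[symmetric] by (simp add: simplicial_chain_group_def)
  have G: "comm_group ?G"
    by (simp add: simplicial_chain_group_def abelian_free_Abelian_group)
  interpret G: comm_group ?G
    by (rule G)
  have Z: "simplicial_cycles r (int k) (order_complex r A)
      = {c \<in> face_chains A (Suc k). chain_bd r c = 0}"
    by (simp add: simplicial_cycles_def carrier)
  have B: "simplicial_boundaries r (int k) (order_complex r A)
      = chain_bd r ` face_chains A (Suc (Suc k))"
    using carrier_simplicial_chain_group[of "Suc k" A]
    by (simp add: simplicial_boundaries_def add.commute)
  have "subgroup {c \<in> face_chains A (Suc k). chain_bd r c = 0} ?G"
    by (rule G.subgroupI) (auto simp: carrier ops inv chain_bd_linear intro: exI[of _ 0])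
  moreover have "subgroup (chain_bd r ` face_chains A (Suc (Suc k))) ?G"
  proof (rule G.subgroupI)
    show "chain_bd r ` face_chains A (Suc (Suc k)) \<subseteq> carrier ?G"
      using chain_bd_face_chains(1) unfolding carrier by blast
    show "chain_bd r ` face_chains A (Suc (Suc k)) \<noteq> {}"
      using face_chains_closed(1) by blast
    show "inv\<^bsub>?G\<^esub> x \<in> chain_bd r ` face_chains A (Suc (Suc k))"
      if "x \<in> chain_bd r ` face_chains A (Suc (Suc k))" for x
    proof -
      from that obtain c where "c \<in> face_chains A (Suc (Suc k))" "x = chain_bd r c"
        by blast
      then show ?thesis
        using chain_bd_face_chains(1)[of c A k]
        by (intro image_eqI[of _ _ "- c"]) (auto simp: inv chain_bd_linear)
    qed
    show "x \<otimes>\<^bsub>?G\<^esub> y \<in> chain_bd r ` face_chains A (Suc (Suc k))"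
      if "x \<in> chain_bd r ` face_chains A (Suc (Suc k))"
        "y \<in> chain_bd r ` face_chains A (Suc (Suc k))" for x y
      using that by (auto simp: ops simp flip: chain_bd_linear)
  qed
  moreover have "chain_bd r ` face_chains A (Suc (Suc k))
      \<subseteq> {c \<in> face_chains A (Suc k). chain_bd r c = 0}"
    using chain_bd_face_chains by blast
  ultimately show ?thesis
    unfolding simplicial_homology_group_def Z B by (rule trivial_quotient_iff[OF G])
qed

lemma trivial_homology_Suc_iff:
  "trivial_group (simplicial_homology_group r (int (Suc k)) (order_complex r A))
    \<longleftrightarrow> exact A (Suc (Suc k))"
proof -
  have "chain_bd r ` face_chains A (Suc (Suc (Suc k))) = boundary ` face_chains A (Suc (Suc (Suc k)))"
    by (rule image_cong[OF refl chain_bd_eq_boundary])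
  moreover have "{c \<in> face_chains A (Suc (Suc k)). chain_bd r c = 0}
      = {c \<in> face_chains A (Suc (Suc k)). boundary c = 0}"
    using chain_bd_eq_boundary by fastforce
  ultimately show ?thesis
    unfolding trivial_homology_iff exact_def by blast
qed

text \<open>
  A vertex is a cycle, but no boundary: the augmentation, which is the boundary of a vertex in the augmented
  complex, vanishes on boundaries.
\<close>

lemma nontrivial_homology_0:
  assumes "A \<noteq> {}"
  shows "\<not> trivial_group (simplicial_homology_group r 0 (order_complex r A))"
proof
  assume "trivial_group (simplicial_homology_group r 0 (order_complex r A))"
  then have *: "{c \<in> face_chains A (Suc 0). chain_bd r c = 0}
      \<subseteq> chain_bd r ` face_chains A (Suc (Suc 0))"
    using trivial_homology_iff[of 0 A] by simp
  obtain y where "y \<in> A"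
    using assms by blast
  then have y: "frag_of {y} \<in> face_chains A (Suc 0)"
    using r_refl by (simp add: faces_iff)
  then obtain e where e: "e \<in> face_chains A (Suc (Suc 0))" "frag_of {y} = chain_bd r e"
    using * chain_bd_vertices by blast
  then have "boundary (frag_of {y}) = 0"
    using boundary_boundary chain_bd_eq_boundary by metis
  then show False
    by (simp add: boundary_of sgn_at_def)
qed

lemma trivial_homology_neg:
  assumes "i < 0"
  shows "trivial_group (simplicial_homology_group r i (order_complex r A))"
proof -
  let ?K = "order_complex r A"
  let ?G = "simplicial_chain_group i ?K"
  have carrier_neg: "carrier (simplicial_chain_group p ?K) = {0}" if "p < 0" for p
  proof -
    have "s \<notin> simplices p ?K" for s
      using that card_gt_0_iff[of s] by (auto simp: simplices_def)
    then have no_simplices: "simplices p ?K = {}"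
      by blast
    show ?thesis
      unfolding simplicial_chain_group_def no_simplices by auto
  qed
  have "simplicial_cycles r i ?K = {0}"
    using assms by (auto simp: simplicial_cycles_def carrier_neg chain_bd_linear)
  moreover have "simplicial_boundaries r i ?K = {0}"
  proof (cases "i + 1 < 0")
    case True
    then show ?thesis
      by (simp add: simplicial_boundaries_def carrier_neg chain_bd_linear)
  next
    case False
    then have "i + 1 = int 0"
      using assms by simp
    then have carrier: "carrier (simplicial_chain_group (i + 1) ?K) = face_chains A (Suc 0)"
      using carrier_simplicial_chain_group[of 0 A] by simp
    have "chain_bd r ` face_chains A (Suc 0) \<subseteq> {0}"
      using chain_bd_vertices by blast
    moreover have "chain_bd r ` face_chains A (Suc 0) \<noteq> {}"
      using face_chains_closed(1) by blast
    ultimately show ?thesis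
      unfolding simplicial_boundaries_def carrier by (metis subset_singletonD)
  qed
  moreover have G: "comm_group ?G" and "\<one>\<^bsub>?G\<^esub> = 0"
    by (simp_all add: simplicial_chain_group_def abelian_free_Abelian_group)
  then have "subgroup {0} ?G"
    using group.triv_subgroup[of ?G] comm_group.axioms(2)[of ?G] by simp
  ultimately show ?thesis
    using trivial_quotient_iff[OF G] unfolding simplicial_homology_group_def by auto
qed

end


section \<open>The interior of \<open>P(a,b)\<close>\<close>

text \<open>
  The upper corner \<open>(a,b)\<close> is kept fixed in all recursions; for positive \<open>p\<close> and \<open>q\<close>,
  the part of a box above one of its elements is again such a box.
\<close>

definition box :: "nat \<Rightarrow> nat \<Rightarrow> nat \<Rightarrow> nat \<Rightarrow> (nat \<times> nat) set" where
  "box a b p q = {p..<a} \<times> {q..<b}"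

interpretation pd: oriented_vertices pd_le
  by standard (rule pd_le_refl, rule pd_le_antisym)

lemma pd_le_iff:
  "pd_le (c, d) (c', d') \<longleftrightarrow>
    c = c' \<and> d = d' \<or> (c = 0 \<and> c' = 0 \<or> c < c') \<and> (d = 0 \<and> d' = 0 \<or> d < d')"
  by (auto simp: pd_le_def properly_divides_def)

text \<open>
  Assembles the box from the cone \<open>?B\<close> over \<open>[p+1,a) \<times> [q+1,b)\<close> with apex \<open>(p,q)\<close> and the antichain \<open>?M\<close> of
  the other minimal elements.  Their links in \<open>?B\<close> are boxes, and \<open>(p,q)\<close> lies below all of these.  That
  \<open>p\<close> and \<open>q\<close> are positive makes elements of the same row or column incomparable.
\<close>

lemma exact_box_Suc:
  assumes "1 \<le> p" "1 \<le> q" "p < a" "q < b"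
  shows "pd.exact (box a b p q) (Suc j) \<longleftrightarrow>
    (\<forall>d\<in>{q<..<b}. pd.exact (box a b (Suc p) (Suc d)) j) \<and>
    (\<forall>c\<in>{p<..<a}. pd.exact (box a b (Suc c) (Suc q)) j)"
proof -
  let ?B = "insert (p, q) (box a b (Suc p) (Suc q))"
  let ?M = "Pair p ` {q<..<b} \<union> (\<lambda>c. (c, q)) ` {p<..<a}"
  have split: "box a b p q = ?B \<union> ?M"
  proof (rule Set.set_eqI)
    fix z :: "nat \<times> nat"
    obtain c d where "z = (c, d)"
      by (cases z)
    then show "z \<in> box a b p q \<longleftrightarrow> z \<in> ?B \<union> ?M"
      using assms by (auto simp: box_def image_iff)
  qed
  have cone: "pd.exact ?B (Suc j)"
    by (rule pd.exact_cone[of "(p, q)"]) (auto simp: box_def pd_le_iff)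
  have link1: "pd.link (p, d) ?B = box a b (Suc p) (Suc d)" if "d \<in> {q<..<b}" for d
    using that assms by (auto simp: pd.link_def box_def pd_le_iff)
  have link2: "pd.link (c, q) ?B = box a b (Suc c) (Suc q)" if "c \<in> {p<..<a}" for c
    using that assms by (auto simp: pd.link_def box_def pd_le_iff)
  have union: "pd.exact (?B \<union> ?M) (Suc j) \<longleftrightarrow>
      pd.exact ?B (Suc j) \<and> (\<forall>x\<in>?M. pd.exact (pd.link x ?B) j)"
  proof (rule pd.exact_Un_antichain)
    show "x = x'" if "x \<in> ?M" "x' \<in> ?M" "pd.comparable x x'" for x x'
      using that assms by (auto simp: pd_le_iff)
  qed (use assms in \<open>auto simp: box_def pd_le_iff\<close>)
  show ?thesis
    unfolding split union using cone link1 link2 by (simp add: ball_Un)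
qed

text \<open>
  In contrapositive form: the nonvanishing at \<open>Suc (Suc k)\<close> comes from one of the smaller boxes in
  degree \<open>Suc k\<close>, and that box is already nonzero in degree \<open>k\<close> if \<open>k > 0\<close>.  For \<open>k = 0\<close>, exactness in degree \<open>1\<close> says that
  no smaller box is empty.  But the last element of a side, \<open>(p,b-1)\<close> or \<open>(a-1,q)\<close>, has nothing above it; hence
  the corner is the only minimal element and the box is a cone.
\<close>

lemma exact_box_downward:
  assumes "1 \<le> p" "1 \<le> q" "pd.exact (box a b p q) (Suc k)"
  shows "pd.exact (box a b p q) (Suc (Suc k))"
  using assms
proof (induction k arbitrary: p q)
  case (0 p q)
  show ?case
  proof (cases "p < a \<and> q < b")
    case True
    have "d \<notin> {q<..<b}" for d
    proof
      assume "d \<in> {q<..<b}"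
      then have "b - 1 \<in> {q<..<b}" and "Suc (b - 1) = b"
        by auto
      then have "box a b (Suc p) b \<noteq> {}"
        using 0 True exact_box_Suc[of p q a b 0] by (metis pd.exact_zero_iff)
      then show False
        by (simp add: box_def)
    qed
    moreover have "c \<notin> {p<..<a}" for c
    proof
      assume "c \<in> {p<..<a}"
      then have "a - 1 \<in> {p<..<a}" and "Suc (a - 1) = a"
        by auto
      then have "box a b a (Suc q) \<noteq> {}"
        using 0 True exact_box_Suc[of p q a b 0] by (metis pd.exact_zero_iff)
      then show False
        by (simp add: box_def)
    qed
    ultimately have "{q<..<b} = {}" "{p<..<a} = {}"
      by blast+
    then show ?thesis
      using 0 True by (simp add: exact_box_Suc)
  next
    case False
    then have "box a b p q = {}"
      by (auto simp: box_def)
    then show ?thesis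
      by (simp add: pd.exact_above_card)
  qed
next
  case (Suc k p q)
  show ?case
  proof (cases "p < a \<and> q < b")
    case True
    then show ?thesis
      using Suc.prems by (simp add: exact_box_Suc[of p q a b "Suc k"] exact_box_Suc[of p q a b "Suc (Suc k)"] Suc.IH)
  next
    case False
    then have "box a b p q = {}"
      by (auto simp: box_def)
    then show ?thesis
      by (simp add: pd.exact_above_card)
  qed
qed

lemma P_set_interior:
  assumes "2 \<le> a" "2 \<le> b"
  shows "P_set a b - {(0, 0), (a, b)} = {..<a} \<times> {..<b} - {(0, 0)}"
  using assms by (auto simp: P_set_def pd_le_iff)

text \<open>
  After removal of the dominated elements, \<open>(1,1)\<close> is the apex of a cone over the box, and \<open>(0,1)\<close> and
  \<open>(1,0)\<close> are two further points with the whole box as their link.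
\<close>

lemma exact_interior_Suc:
  assumes "2 \<le> a" "2 \<le> b"
  shows "pd.exact ({..<a} \<times> {..<b} - {(0, 0)}) (Suc j) \<longleftrightarrow> pd.exact (box a b 2 2) j"
proof -
  let ?B = "insert (1, 1) (box a b 2 2)"
  let ?C = "?B \<union> {(0, 1), (1, 0)}"
  let ?M1 = "{0, 1} \<times> {2..<b}" and ?M2 = "{2..<a} \<times> {0, 1}"
  have "{..<a} \<times> {..<b} - {(0, 0)} = (?C \<union> ?M1) \<union> ?M2"
  proof (rule Set.set_eqI)
    fix z :: "nat \<times> nat"
    obtain c d where "z = (c, d)"
      by (cases z)
    then show "z \<in> {..<a} \<times> {..<b} - {(0, 0)} \<longleftrightarrow> z \<in> (?C \<union> ?M1) \<union> ?M2"
      using assms by (auto simp: box_def)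
  qed
  moreover have "pd.exact ((?C \<union> ?M1) \<union> ?M2) (Suc j) \<longleftrightarrow> pd.exact (?C \<union> ?M1) (Suc j)"
    by (rule pd.exact_Un_dominated[of _ "(1, 0)"]) (auto simp: box_def pd_le_iff)
  moreover have "pd.exact (?C \<union> ?M1) (Suc j) \<longleftrightarrow> pd.exact ?C (Suc j)"
    by (rule pd.exact_Un_dominated[of _ "(0, 1)"]) (auto simp: box_def pd_le_iff)
  moreover have "pd.exact ?C (Suc j) \<longleftrightarrow>
      pd.exact ?B (Suc j) \<and> (\<forall>x\<in>{(0, 1), (1, 0)}. pd.exact (pd.link x ?B) j)"
    by (rule pd.exact_Un_antichain[of _ _ "(1, 1)"]) (auto simp: box_def pd_le_iff)
  moreover have "pd.exact ?B (Suc j)"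
    by (rule pd.exact_cone[of "(1, 1)"]) (auto simp: box_def pd_le_iff)
  moreover have "pd.link (0, 1) ?B = box a b 2 2" "pd.link (1, 0) ?B = box a b 2 2"
    by (auto simp: pd.link_def box_def pd_le_iff)
  ultimately show ?thesis
    by simp
qed

theorem proposition1p4:
  fixes a b :: nat
  assumes "2 \<le> a" and "a \<le> b"
  shows "\<exists>t::int. t \<ge> 0 \<and>
    (\<forall>i::int. \<not> trivial_group (simplicial_homology_group pd_le i (Delta_P a b)) \<longleftrightarrow> 0 \<le> i \<and> i \<le> t)"
proof -
  let ?Q = "{..<a} \<times> {..<b} - {(0, 0)}"
  \<comment> \<open>the dimensions with nonzero homology: \<open>k\<close> is both a dimension of the interior and a degree, i.e. dimension
      plus one, of the box, since suspending raises the dimension by one\<close>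
  define S where "S = {k. k = 0 \<or> \<not> pd.exact (box a b 2 2) k}"
  have Delta: "Delta_P a b = order_complex pd_le ?Q"
    using assms by (simp add: Delta_P_def P_set_interior)
  have nontrivial: "\<not> trivial_group (simplicial_homology_group pd_le (int k) (Delta_P a b)) \<longleftrightarrow> k \<in> S" for k
  proof (cases k)
    case 0
    have "(0, 1) \<in> ?Q"
      using assms by simp
    then show ?thesis
      using pd.nontrivial_homology_0[of ?Q] 0 unfolding Delta S_def by auto
  next
    case (Suc j)
    then show ?thesis
      unfolding Delta S_def using assms
      by (simp only: pd.trivial_homology_Suc_iff exact_interior_Suc[of a b]) simp
  qed
  have down: "k \<in> S" if "Suc k \<in> S" for k
  proof (cases k)
    case (Suc j)
    then show ?thesis
      using that exact_box_downward[of 2 2 a b j] unfolding S_def by auto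
  qed (simp add: S_def)
  have "S \<subseteq> {..card (box a b 2 2)}"
    using pd.exact_above_card[of "box a b 2 2"] unfolding S_def
    by (auto simp: box_def not_le[symmetric])
  then have fin: "finite S"
    by (rule finite_subset) simp
  have "k \<in> S" if "k \<le> Max S" for k
  proof -
    have "Max S \<in> S"
      using fin by (intro Max_in) (auto simp: S_def)
    with that show ?thesis
      by (induction rule: inc_induct) (auto intro: down)
  qed
  then have S_iff: "k \<in> S \<longleftrightarrow> k \<le> Max S" for k
    using Max_ge[OF fin] by blast
  show ?thesis
  proof (intro exI[of _ "int (Max S)"] conjI allI)
    fix i :: int
    show "\<not> trivial_group (simplicial_homology_group pd_le i (Delta_P a b)) \<longleftrightarrow> 0 \<le> i \<and> i \<le> int (Max S)"
    proof (cases "i < 0")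
      case True
      then show ?thesis
        using pd.trivial_homology_neg Delta by simp
    next
      case False
      then obtain k where "i = int k"
        by (metis nonneg_int_cases not_le)
      then show ?thesis
        using nontrivial[of k] S_iff[of k] by simp
    qed
  qed simp
qed

end
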